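(* There exists an absolute constant $c>0$ such that for every integer $N\ge 2$, $$\int_0^1\left|\sum_{n=1}^N \mu(n) e(n\alpha)\right|\,d\alpha\;\ge\; c\,\frac{N^{1/8}}{(\log N)^{1/2}}.$$
   Context: For real $x$, $e(x)=e^{2\pi i x}$. $\mu$ is the Möbius function. *)

theory Defs
  imports "HOL-Analysis.Analysis" "HOL-Computational_Algebra.Computational_Algebra"
begin

(* At n = 0 the value is 0, since 0 is not squarefree. *)
definition moebius_mu :: "nat \<Rightarrow> int" where
  "moebius_mu n = (if squarefree n then (-1) ^ card (prime_factors n) else 0)"

definition unit_char :: "real \<Rightarrow> complex" where
  "unit_char x = exp (2 * complex_of_real pi * \<i> * complex_of_real x)"

end

theory Submission
  imports Defs
begin

text \<open>Let \<open>S\<close> be the exponential sum and \<open>I\<close> its \<open>L\<^sup>1\<close> norm. For a prime \<open>p\<close>, the vanishing of \<open>\<mu>\<close> on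
  the multiples of \<open>p\<^sup>2\<close> says that \<open>S(\<alpha>)\<close> is minus the sum of the shifts \<open>S(\<alpha> + a/p\<^sup>2)\<close> over
  \<open>1 \<le> a < p\<^sup>2\<close>. Hence convolving \<open>S\<close> with the sum \<open>K\<close> of the Fejer kernels of length \<open>2N\<close>
  centred at all \<open>a/p\<^sup>2\<close> with \<open>p \<le> P\<close> multiplies the coefficients of \<open>S\<close> by \<open>-\<pi>(P)\<close>, up to weights in
  \<open>[1/2, 1]\<close>. If \<open>P\<^sup>4 \<le> 2N\<close>, the centres are \<open>1/(2N)\<close>-spaced modulo 1, so that \<open>K = O(N)\<close> and the
  convolution is \<open>O(N I)\<close> everywhere. Pairing it with \<open>S\<close> gives
  \<open>\<pi>(P) \<Sum>\<^sub>n |\<mu>(n)|\<^sup>2 = O(N I\<^sup>2)\<close>; now use that the squarefree numbers have positive density and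
  Chebyshev's bound \<open>\<pi>(P) \<ge> c P / ln P\<close> with \<open>P\<close> of order \<open>N\<close> to the power \<open>1/4\<close>.\<close>

section \<open>Counting primes and squarefree numbers\<close>

text \<open>Leibniz's harmonic triangle: the reciprocals of \<open>k * (n choose k)\<close> are integer combinations
  of \<open>1, 1/2, \<dots>, 1/n\<close>.\<close>

lemma mult_binomial_dvd:
  fixes M n k :: nat
  assumes "\<And>i. 1 \<le> i \<Longrightarrow> i \<le> n \<Longrightarrow> i dvd M" "1 \<le> k" "k \<le> n"
  shows "k * (n choose k) dvd M"
  using assms(2,1,3)
proof (induction k arbitrary: n rule: dec_induct)
  case base
  then show ?case by simp
next
  case (step k)
  obtain r where r: "n = Suc r" using step.prems by (cases n) auto
  define C where "C = (r choose k)"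
  \<comment> \<open>The recursion behind the triangle is \<open>1/((k+1) * (n choose (k+1))) = 1/(k
    * (r choose k)) - 1/(k * (n choose k))\<close>. With the cofactors \<open>a\<close> and
    \<open>b\<close> of the two entries in column \<open>k\<close>, the new entry has cofactor
    \<open>a - b\<close>, which is why the computation moves to the integers.\<close>
  have "k * (r choose k) dvd M" and "k * (n choose k) dvd M"
    using step.IH[of r] step.IH[of n] step.prems r by auto
  then obtain a b where a: "M = k * C * a" and b: "M = k * (n choose k) * b"
    unfolding C_def dvd_def by blast
  have 1: "(n - k) * (n choose k) = n * C"
    using binomial_absorb_comp[of n k] by (simp add: r C_def)
  have 2: "Suc k * (n choose Suc k) = n * C"
    unfolding r C_def by (metis Suc_times_binomial mult.commute)
  have C: "C > 0" "k > 0" using step r by (auto simp: C_def)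
  have "k * C * (n * b) = (n - k) * (k * (n choose k) * b)"
    using 1 by (metis (no_types, opaque_lifting) mult.assoc mult.commute)
  also have "\<dots> = (n - k) * M" by (simp only: b)
  also have "\<dots> = k * C * ((n - k) * a)" by (simp only: a mult_ac)
  finally have "n * b = (n - k) * a" using C by simp
  hence "int n * int b = (int n - int k) * int a"
    using step.prems by (metis Suc_leD of_nat_diff of_nat_mult)
  hence ka: "int k * int a = int n * (int a - int b)" by (simp add: algebra_simps)
  have "int M = int (n * C) * (int a - int b)"
    using ka by (simp add: a mult.assoc mult.left_commute)
  hence "int (n * C) dvd int M" by simp
  thus ?case unfolding 2 by (simp only: int_dvd_int_iff)
qed

text \<open>The number \<open>M\<close> built from the largest prime powers up to \<open>n\<close>
  is the least common multiple of \<open>1, ..., n\<close>, so the binomial coefficient divides it.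
  \<open>M\<close> has one factor for each prime up to \<open>n\<close>, and each factor is at most
  \<open>n\<close>.\<close>

lemma binomial_le_power_primes:
  fixes n k :: nat
  assumes "1 \<le> k" "k \<le> n"
  shows "n choose k \<le> n ^ card {p. prime p \<and> p \<le> n}"
proof -
  define A where "A = {p. prime p \<and> p \<le> n}"
  define e where "e p = (GREATEST j. p ^ j \<le> n)" for p :: nat
  define M where "M = (\<Prod>p\<in>A. p ^ e p)"
  have [simp]: "finite A" by (auto simp: A_def)
  have bd: "j \<le> n" if "prime p" "p ^ j \<le> n" for p j
  proof -
    have "j < 2 ^ j" by (rule less_exp)
    also have "\<dots> \<le> p ^ j" using prime_ge_2_nat[OF that(1)] by (intro power_mono) auto
    finally show ?thesis using that by simp
  qed
  have e1: "p ^ e p \<le> n" if "prime p" for p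
    unfolding e_def by (rule GreatestI_nat[where k=0 and b=n]) (use assms bd that in auto)
  have e2: "j \<le> e p" if "prime p" "p ^ j \<le> n" for p j
    unfolding e_def by (rule Greatest_le_nat[where b=n]) (use bd that in auto)
  have M: "M > 0" unfolding M_def using prime_gt_0_nat by (intro prod_pos) (auto simp: A_def)
  have "i dvd M" if i: "1 \<le> i" "i \<le> n" for i
  proof (rule multiplicity_le_imp_dvd)
    fix p :: nat assume p: "prime p"
    have le: "p ^ multiplicity p i \<le> i"
      using i by (intro dvd_imp_le multiplicity_dvd) auto
    show "multiplicity p i \<le> multiplicity p M"
    proof (cases "multiplicity p i = 0")
      case False
      have "p ^ 1 \<le> p ^ multiplicity p i"
        using False prime_gt_0_nat[OF p] by (intro power_increasing) auto
      hence "p \<in> A" using le i p by (auto simp: A_def)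
      moreover have "multiplicity p M = (if p \<in> A then e p else 0)"
        unfolding M_def by (rule multiplicity_prod_prime_powers) (use p in \<open>auto simp: A_def\<close>)
      ultimately show ?thesis using e2[OF p, of "multiplicity p i"] le i by simp
    qed simp
  qed (use i in auto)
  hence "k * (n choose k) dvd M" using assms by (intro mult_binomial_dvd) auto
  hence "n choose k dvd M" by (rule dvd_mult_right)
  hence "n choose k \<le> M" using M by (intro dvd_imp_le)
  also have "M \<le> (\<Prod>p\<in>A. n)" unfolding M_def by (intro prod_mono) (auto simp: A_def e1)
  finally show ?thesis by (simp add: A_def)
qed

text \<open>The central binomial coefficient is at least \<open>2 ^ m\<close>; comparing this with
  the bound by a power of \<open>2 * m\<close> and taking logarithms bounds the number of primes
  from below.\<close>

lemma chebyshev_lower: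
  fixes m :: nat
  assumes "m \<ge> 1"
  shows "real m * ln 2 \<le> real (card {p. prime p \<and> p \<le> 2 * m}) * ln (real (2 * m))"
proof -
  have "2 ^ m \<le> (2 * m) choose m"
    using binomial_ge_n_over_k_pow_k[of m "2 * m", where 'a = real] assms by simp
  also have "\<dots> \<le> (2 * m) ^ card {p. prime p \<and> p \<le> 2 * m}"
    using assms by (intro binomial_le_power_primes) auto
  finally have "real (2 ^ m) \<le> real ((2 * m) ^ card {p. prime p \<and> p \<le> 2 * m})"
    by (simp only: of_nat_le_iff)
  hence "ln (real (2 ^ m)) \<le> ln (real ((2 * m) ^ card {p. prime p \<and> p \<le> 2 * m}))"
    using assms by (intro ln_mono) auto
  thus ?thesis using assms by (subst (asm) (1 2) of_nat_power, subst (asm) (1 2) ln_realpow) auto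
qed

section \<open>Density of the squarefree numbers\<close>

lemma sum_inverse_squares_le: "(\<Sum>d=2..n. 1 / real d ^ 2) \<le> 3 / 4"
proof -
  \<comment> \<open>The extra \<open>- 1 / n\<close> makes the induction telescope; at
    \<open>n = 2\<close> there is equality.\<close>
  have "(\<Sum>d=2..n. 1 / real d ^ 2) \<le> 3 / 4 - 1 / n" if "n \<ge> 2"
    using that
  proof (induction n rule: dec_induct)
    case (step n)
    have "1 / real (Suc n) ^ 2 \<le> 1 / (real n * real (Suc n))"
      using step by (intro divide_left_mono) (auto simp: power2_eq_square)
    also have "\<dots> = 1 / n - 1 / Suc n" using step by (simp add: field_simps)
    finally have "1 / real (Suc n) ^ 2 \<le> 1 / n - 1 / Suc n" .
    thus ?case using step by simp
  qed simp
  moreover have "1 / real n \<ge> 0" by simp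
  ultimately show ?thesis by (cases "n \<ge> 2") (linarith, simp)
qed

text \<open>Every number that is not squarefree is a multiple of some \<open>d ^ 2\<close> with
  \<open>d \<ge> 2\<close>. By the union bound these cover at most three quarters of
  \<open>{1..N}\<close>.\<close>

lemma card_squarefree_ge:
  "real (card {n\<in>{1..N}. squarefree n}) \<ge> real N / 4"
proof -
  define B where "B d = {n\<in>{1..N}. d ^ 2 dvd n}" for d
  have card_B: "real (card (B d)) \<le> real N * (1 / real d ^ 2)" if "d \<ge> 2" for d
  proof -
    have "B d \<subseteq> (\<lambda>k. d ^ 2 * k) ` {1..N div d ^ 2}"
    proof
      fix n assume n: "n \<in> B d"
      then obtain k where k: "n = d ^ 2 * k" by (auto simp: B_def)
      have "k = n div d ^ 2" using k that by simp
      also have "\<dots> \<le> N div d ^ 2" using n by (intro div_le_mono) (auto simp: B_def)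
      finally show "n \<in> (\<lambda>k. d ^ 2 * k) ` {1..N div d ^ 2}"
        using n k by (auto simp: B_def Suc_le_eq intro!: Nat.gr0I)
    qed
    hence "card (B d) \<le> N div d ^ 2"
      using surj_card_le[of "{1..N div d ^ 2}" "B d"] by simp
    also have "real (N div d ^ 2) \<le> real N / real (d ^ 2)" by (rule of_nat_div_le_of_nat)
    finally show ?thesis by simp
  qed
  have "{1..N} \<subseteq> {n\<in>{1..N}. squarefree n} \<union> (\<Union>d\<in>{2..N}. B d)"
  proof
    fix n assume n: "n \<in> {1..N}"
    show "n \<in> {n\<in>{1..N}. squarefree n} \<union> (\<Union>d\<in>{2..N}. B d)"
    proof (cases "squarefree n")
      case False
      then obtain d where d: "d ^ 2 dvd n" "\<not> is_unit d" unfolding squarefree_def by auto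
      have "d \<noteq> 0" using d n by (intro notI) auto
      moreover have "d dvd n" using d(1) by (metis dvd_mult_left power2_eq_square)
      hence "d \<le> n" using n by (intro dvd_imp_le) auto
      ultimately show ?thesis using d n by (force simp: B_def)
    qed (use n in auto)
  qed
  hence "card {1..N} \<le> card ({n\<in>{1..N}. squarefree n} \<union> (\<Union>d\<in>{2..N}. B d))"
    by (intro card_mono) (auto simp: B_def)
  also have "\<dots> \<le> card {n\<in>{1..N}. squarefree n} + card (\<Union>d\<in>{2..N}. B d)"
    by (rule card_Un_le)
  also have "card (\<Union>d\<in>{2..N}. B d) \<le> (\<Sum>d=2..N. card (B d))"
    by (rule card_UN_le) simp
  finally have "real N \<le> real (card {n\<in>{1..N}. squarefree n}) + (\<Sum>d=2..N. real (card (B d)))"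
    by (simp flip: of_nat_sum of_nat_add)
  also have "(\<Sum>d=2..N. real (card (B d))) \<le> (\<Sum>d=2..N. real N * (1 / real d ^ 2))"
    using card_B by (intro sum_mono) auto
  also have "\<dots> \<le> real N * (3 / 4)"
    unfolding sum_distrib_left[symmetric] by (intro mult_left_mono sum_inverse_squares_le) simp
  finally show ?thesis by simp
qed

section \<open>The Fejer kernel on well-spaced points\<close>

lemma unit_char_conv_cis: "unit_char x = cis (2 * pi * x)"
  by (simp add: unit_char_def cis_conv_exp mult_ac)

lemma norm_unit_char [simp]: "norm (unit_char x) = 1"
  by (simp add: unit_char_conv_cis)

lemma unit_char_add: "unit_char (x + y) = unit_char x * unit_char y"
  by (simp add: unit_char_conv_cis cis_mult algebra_simps)

lemma unit_char_diff: "unit_char (x - y) = unit_char x * cnj (unit_char y)"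
  by (simp add: unit_char_conv_cis cis_cnj cis_mult algebra_simps)

lemma unit_char_of_int [simp]: "unit_char (of_int k) = 1"
  by (simp add: unit_char_conv_cis cis.ctr complex_eq_iff)

lemma unit_char_0 [simp]: "unit_char 0 = 1"
  using unit_char_of_int[of 0] by simp

lemma unit_char_power: "unit_char (real k * x) = unit_char x ^ k"
  by (simp add: unit_char_conv_cis Complex.DeMoivre mult_ac)

lemma continuous_on_unit_char [continuous_intros]:
  "continuous_on A f \<Longrightarrow> continuous_on A (\<lambda>x. unit_char (f x))"
  unfolding unit_char_def by (intro continuous_intros)

lemma has_integral_unit_char:
  "((\<lambda>t. unit_char (of_int k * t)) has_integral of_bool (k = 0)) {0..1}"
proof (cases "k = 0")
  case True
  then show ?thesis using has_integral_const_real[of "1::complex" 0 1] by simp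
next
  case False
  define G where "G t = unit_char (of_int k * t) / (2 * of_real pi * \<i> * of_int k)" for t
  have "((\<lambda>t. unit_char (of_int k * t)) has_integral (G 1 - G 0)) {0..1}"
  proof (rule fundamental_theorem_of_calculus)
    fix x :: real
    show "(G has_vector_derivative unit_char (of_int k * x)) (at x within {0..1})"
      unfolding G_def unit_char_def
      by (rule derivative_eq_intros has_vector_derivative_real_field refl | (use False in simp))+
  qed simp
  moreover have "G 1 - G 0 = 0" using unit_char_of_int[of k] by (simp add: G_def)
  ultimately show ?thesis using False by simp
qed

text \<open>This is a full geometric sum whose ratio \<open>z\<close> is a \<open>q\<close>-th root
  of unity different from 1.\<close>

lemma sum_unit_char_roots:
  fixes q n :: nat
  assumes "q > 0" "\<not> q dvd n"
  shows "(\<Sum>a<q. unit_char (real n * (real a / real q))) = 0"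
proof -
  define z where "z = unit_char (real n / real q)"
  have "z \<noteq> 1"
  proof
    assume "z = 1"
    then obtain j :: int where "2 * pi * (real n / real q) = 2 * pi * j"
      by (auto simp: z_def unit_char_conv_cis cis_conv_exp exp_eq_1 mult_ac)
    hence "real n = real_of_int j * real q" using assms by (simp add: field_simps)
    hence "int n = j * int q" by (metis of_int_eq_iff of_int_mult of_int_of_nat_eq)
    hence "int q dvd int n" by simp
    thus False using assms by simp
  qed
  moreover have "z ^ q = 1"
    using assms unit_char_of_int[of "int n"] by (simp add: z_def flip: unit_char_power)
  moreover have "(\<Sum>a<q. unit_char (real n * (real a / real q))) = (\<Sum>a<q. z ^ a)"
    by (simp add: z_def mult_ac flip: unit_char_power)
  ultimately show ?thesis using sum_gp_strict[of z q] by simp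
qed

text \<open>Jordan's inequality: the concave sine lies above its chord from 0 to
  \<open>pi / 2\<close>.\<close>

lemma sin_ge_linear:
  fixes y :: real
  assumes "0 \<le> y" "y \<le> pi / 2"
  shows "2 / pi * y \<le> sin y"
proof -
  have "convex_on {0..pi/2} (\<lambda>x. - sin x)"
    by (rule f''_ge0_imp_convex[where f' = "\<lambda>x. - cos x" and f'' = sin])
       (auto intro!: derivative_eq_intros sin_ge_zero)
  from convex_onD_Icc'[OF this, of y] assms show ?thesis by simp
qed

lemma norm_unit_char_minus_1: "norm (unit_char x - 1) = 2 * \<bar>sin (pi * x)\<bar>"
proof -
  have "norm (unit_char x - 1) = 2 * \<bar>sin (2 * pi * x / 2)\<bar>"
    unfolding unit_char_conv_cis using dist_exp_i_1[of "2 * pi * x"] by (simp add: cis_conv_exp)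
  thus ?thesis by simp
qed

lemma norm_unit_char_minus_1_ge:
  assumes "\<bar>x\<bar> \<le> 1 / 2"
  shows "norm (unit_char x - 1) \<ge> 4 * \<bar>x\<bar>"
proof -
  have "2 / pi * (pi * \<bar>x\<bar>) \<le> sin (pi * \<bar>x\<bar>)"
    using assms by (intro sin_ge_linear) auto
  also have "\<dots> \<le> \<bar>sin (pi * x)\<bar>" by (cases "x \<ge> 0") (auto simp: abs_if)
  finally show ?thesis unfolding norm_unit_char_minus_1 by simp
qed

text \<open>For \<open>L > 0\<close> this is the Fejer kernel with Fourier coefficients
  \<open>1 - |k| / L\<close> for \<open>|k| < L\<close>. The form as a squared Dirichlet-type sum
  makes it visibly nonnegative and gives the decay by a geometric series.\<close>

definition fejer :: "nat \<Rightarrow> real \<Rightarrow> real" where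
  "fejer L t = (norm (\<Sum>k<L. unit_char (real k * t)))\<^sup>2 / real L"

lemma fejer_nonneg: "fejer L t \<ge> 0"
  by (simp add: fejer_def)

lemma fejer_add_int: "fejer L (t + of_int k) = fejer L t"
proof -
  have "unit_char (real j * (t + of_int k)) = unit_char (real j * t)" for j
    using unit_char_of_int[of "int j * k"] by (simp add: distrib_left unit_char_add)
  thus ?thesis by (simp add: fejer_def)
qed

lemma fejer_le_length: "fejer L t \<le> real L"
proof (cases "L = 0")
  case False
  have "norm (\<Sum>k<L. unit_char (real k * t)) \<le> (\<Sum>k<L. 1)"
    by (rule sum_norm_le) simp
  hence "(norm (\<Sum>k<L. unit_char (real k * t)))\<^sup>2 \<le> (real L)\<^sup>2" by (intro power_mono) auto
  thus ?thesis using False by (simp add: fejer_def power2_eq_square divide_le_eq)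
qed (simp add: fejer_def)

lemma fejer_le_decay:
  assumes "\<bar>t\<bar> \<le> 1 / 2" "t \<noteq> 0"
  shows "fejer L t \<le> 1 / (4 * real L * t\<^sup>2)"
proof -
  define z where "z = unit_char t"
  have z: "norm (z - 1) \<ge> 4 * \<bar>t\<bar>" using norm_unit_char_minus_1_ge[OF assms(1)] by (simp add: z_def)
  hence "z \<noteq> 1" using assms by auto
  have "(\<Sum>k<L. unit_char (real k * t)) = (z ^ L - 1) / (z - 1)"
    using \<open>z \<noteq> 1\<close> by (simp add: unit_char_power z_def[symmetric] geometric_sum)
  also have "norm \<dots> \<le> 2 / (4 * \<bar>t\<bar>)"
    unfolding norm_divide
  proof (rule frac_le)
    show "norm (z ^ L - 1) \<le> 2"
      using norm_triangle_ineq4[of "z ^ L" 1] by (simp add: norm_power z_def)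
  qed (use z assms in auto)
  finally have "(norm (\<Sum>k<L. unit_char (real k * t)))\<^sup>2 \<le> (1 / (2 * \<bar>t\<bar>))\<^sup>2"
    by (intro power_mono) auto
  hence "fejer L t \<le> (1 / (2 * \<bar>t\<bar>))\<^sup>2 / real L"
    unfolding fejer_def by (rule divide_right_mono) simp
  thus ?thesis by (simp add: power_divide power_mult_distrib mult_ac)
qed

text \<open>Here \<open>m\<close> is a number of cells of length \<open>1 / L\<close> that fit
  between 0 and \<open>t\<close>. The trivial bound (\<open>m = 0\<close>) and the quadratic decay
  (\<open>m \<ge> 1\<close>) are merged into one expression whose sum over \<open>m\<close>
  telescopes.\<close>

lemma fejer_le_cell:
  fixes m :: nat
  assumes "\<bar>t\<bar> \<le> 1 / 2" "real m \<le> real L * \<bar>t\<bar>" "L > 0"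
  shows "fejer L t \<le> 2 * real L * (1 / ((real m + 1) * (real m + 2)))"
proof (cases "m = 0")
  case True
  then show ?thesis using fejer_le_length[of L t] by simp
next
  case False
  hence t: "t \<noteq> 0" using assms by auto
  have "(real m)\<^sup>2 \<le> (real L * \<bar>t\<bar>)\<^sup>2" using assms by (intro power_mono) auto
  hence 1: "(real m)\<^sup>2 \<le> (real L)\<^sup>2 * t\<^sup>2" by (simp add: power_mult_distrib)
  have "1 * m \<le> m * m" using False by (intro mult_right_mono) auto
  hence "real m \<le> (real m)\<^sup>2" by (simp add: power2_eq_square flip: of_nat_mult)
  have "1 \<le> real m" using False by simp
  have 2: "(real m + 1) * (real m + 2) \<le> 8 * (real m)\<^sup>2"
  proof -
    have "(real m + 1) * (real m + 2) = (real m)\<^sup>2 + 3 * real m + 2"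
      by (simp add: algebra_simps power2_eq_square)
    thus ?thesis using \<open>real m \<le> (real m)\<^sup>2\<close> \<open>1 \<le> real m\<close> by linarith
  qed
  have "fejer L t \<le> 1 / (4 * real L * t\<^sup>2)" by (rule fejer_le_decay[OF assms(1) t])
  also have "\<dots> = 2 * real L * (1 / (8 * ((real L)\<^sup>2 * t\<^sup>2)))"
    using assms t by (simp add: field_simps power2_eq_square)
  also have "\<dots> \<le> 2 * real L * (1 / ((real m + 1) * (real m + 2)))"
    using 1 2 by (intro mult_left_mono divide_left_mono mult_pos_pos) (use assms t in auto)
  finally show ?thesis .
qed

lemma sum_telescope_le:
  assumes "finite (A :: nat set)"
  shows "(\<Sum>m\<in>A. 1 / ((real m + 1) * (real m + 2))) \<le> 1"
proof -
  obtain n where n: "A \<subseteq> {..<n}" using assms finite_nat_iff_bounded by auto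
  have "(\<Sum>m\<in>A. 1 / ((real m + 1) * (real m + 2))) \<le> (\<Sum>m<n. 1 / ((real m + 1) * (real m + 2)))"
    using n by (intro sum_mono2) auto
  also have "\<dots> = 1 - 1 / (real n + 1)"
  proof (induction n)
    case (Suc n)
    have "1 / ((real n + 1) * (real n + 2)) = 1 / (real n + 1) - 1 / (real (Suc n) + 1)"
      by (simp add: divide_simps)
    with Suc show ?case by simp
  qed simp
  also have "\<dots> \<le> 1" by simp
  finally show ?thesis .
qed

text \<open>Modulo 1, each cell of length \<open>1 / L\<close> contains at most one of the points.
  The cell bounds then sum to at most \<open>2 * L\<close> on either side of 0.\<close>

lemma sum_fejer_le:
  assumes "finite I" "L > 0"
  assumes spaced: "\<And>i j k. i \<in> I \<Longrightarrow> j \<in> I \<Longrightarrow> i \<noteq> j \<Longrightarrow> \<bar>x i - x j - of_int k\<bar> \<ge> 1 / real L"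
  shows "(\<Sum>i\<in>I. fejer L (x i)) \<le> 4 * real L"
proof -
  define y where "y i = x i - of_int (round (x i))" for i
  define c where "c i = \<lfloor>real L * y i\<rfloor>" for i
  define w where "w m = 2 * real L * (1 / ((real m + 1) * (real m + 2)))" for m :: nat
  have y: "\<bar>y i\<bar> \<le> 1 / 2" for i
    using of_int_round_abs_le[of "x i"] by (simp add: y_def abs_minus_commute)
  have fx: "fejer L (x i) = fejer L (y i)" for i
    using fejer_add_int[of L "x i" "- round (x i)"] by (simp add: y_def)
  have inj: "inj_on c I"
  proof (rule inj_onI, rule ccontr)
    fix i j assume ij: "i \<in> I" "j \<in> I" "c i = c j" "i \<noteq> j"
    have "\<bar>real L * y i - real L * y j\<bar> < 1" using ij(3) unfolding c_def by linarith
    also have "real L * y i - real L * y j = real L * (y i - y j)" by (simp add: algebra_simps)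
    finally have "real L * \<bar>y i - y j\<bar> < 1" by (simp add: abs_mult)
    hence "\<bar>y i - y j\<bar> < 1 / real L" using assms by (simp add: field_simps)
    moreover have "y i - y j = x i - x j - of_int (round (x i) - round (x j))" by (simp add: y_def)
    ultimately show False using spaced[OF ij(1,2,4)] by (metis not_le)
  qed
  have pos: "fejer L (x i) \<le> w (nat (c i))" if "c i \<ge> 0" for i
    unfolding fx w_def
  proof (rule fejer_le_cell[OF y _ assms(2)])
    have "real (nat (c i)) \<le> real L * y i" using that by (simp add: c_def)
    also have "\<dots> \<le> real L * \<bar>y i\<bar>" by (intro mult_left_mono) auto
    finally show "real (nat (c i)) \<le> real L * \<bar>y i\<bar>" .
  qed
  \<comment> \<open>Left of 0 the end of the cell nearest to 0 is \<open>(c i + 1) / L\<close>,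
    hence the shift by one.\<close>
  have neg: "fejer L (x i) \<le> w (nat (- c i - 1))" if "\<not> c i \<ge> 0" for i
    unfolding fx w_def
  proof (rule fejer_le_cell[OF y _ assms(2)])
    have "real (nat (- c i - 1)) \<le> - (real L * y i)" using that unfolding c_def by linarith
    also have "\<dots> = real L * (- y i)" by simp
    also have "\<dots> \<le> real L * \<bar>y i\<bar>" by (intro mult_left_mono) auto
    finally show "real (nat (- c i - 1)) \<le> real L * \<bar>y i\<bar>" .
  qed
  have half: "(\<Sum>i\<in>J. w (f i)) \<le> 2 * real L" if "finite J" "inj_on f J" for J f
  proof -
    have "(\<Sum>i\<in>J. w (f i)) = (\<Sum>m\<in>f ` J. w m)" using that by (simp add: sum.reindex)
    also have "\<dots> = 2 * real L * (\<Sum>m\<in>f ` J. 1 / ((real m + 1) * (real m + 2)))"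
      by (simp add: w_def sum_distrib_left)
    also have "\<dots> \<le> 2 * real L * 1" using that by (intro mult_left_mono sum_telescope_le) auto
    finally show ?thesis by simp
  qed
  define I1 where "I1 = {i\<in>I. c i \<ge> 0}"
  define I2 where "I2 = {i\<in>I. \<not> c i \<ge> 0}"
  have "(\<Sum>i\<in>I. fejer L (x i)) = (\<Sum>i\<in>I1. fejer L (x i)) + (\<Sum>i\<in>I2. fejer L (x i))"
    using assms by (subst sum.union_disjoint[symmetric]) (auto simp: I1_def I2_def intro!: sum.cong)
  also have "(\<Sum>i\<in>I1. fejer L (x i)) \<le> (\<Sum>i\<in>I1. w (nat (c i)))"
    by (intro sum_mono pos) (auto simp: I1_def)
  also have "\<dots> \<le> 2 * real L"
    using inj assms by (intro half) (auto simp: I1_def inj_on_def eq_nat_nat_iff)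
  also have "(\<Sum>i\<in>I2. fejer L (x i)) \<le> (\<Sum>i\<in>I2. w (nat (- c i - 1)))"
    by (intro sum_mono neg) (auto simp: I2_def)
  also have "\<dots> \<le> 2 * real L"
    using inj assms by (intro half) (auto simp: I2_def inj_on_def eq_nat_nat_iff)
  finally show ?thesis by simp
qed

section \<open>The lower bound for the mean\<close>

lemma fejer_conv_sum:
  "complex_of_real (fejer L t) =
     (\<Sum>j<L. \<Sum>l<L. unit_char (of_int (int j - int l) * t)) / of_nat L"
proof -
  define D where "D = (\<Sum>k<L. unit_char (real k * t))"
  have "complex_of_real (fejer L t) = D * cnj D / of_nat L"
    by (simp add: fejer_def D_def[symmetric] flip: complex_norm_square)
  also have "D * cnj D = (\<Sum>j<L. \<Sum>l<L. unit_char (real j * t) * cnj (unit_char (real l * t)))"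
    by (simp add: D_def sum_product)
  also have "\<dots> = (\<Sum>j<L. \<Sum>l<L. unit_char (of_int (int j - int l) * t))"
    by (simp add: left_diff_distrib unit_char_diff)
  finally show ?thesis .
qed

text \<open>Convolution with the kernel multiplies a character by the corresponding Fourier
  coefficient: among the \<open>L\<^sup>2\<close> terms of the expanded kernel, orthogonality keeps
  those with \<open>j - l = n\<close>.\<close>

lemma has_integral_unit_char_fejer:
  assumes "n < L"
  shows "((\<lambda>t. unit_char (real n * t) * of_real (fejer L (x - t))) has_integral
           of_real (1 - real n / real L) * unit_char (real n * x)) {0..1}"
proof -
  have eq: "unit_char (real n * t) * of_real (fejer L (x - t)) =
      (\<Sum>j<L. \<Sum>l<L. unit_char (of_int (int j - int l) * x) / of_nat L *
        unit_char (of_int (int n - (int j - int l)) * t))" (is "_ = ?R t") for t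
  proof -
    have "unit_char (real n * t) * unit_char (of_int (int j - int l) * (x - t)) =
        unit_char (of_int (int j - int l) * x) * unit_char (of_int (int n - (int j - int l)) * t)" for j l
      unfolding unit_char_add[symmetric] by (rule arg_cong[where f = unit_char]) (simp add: algebra_simps)
    thus ?thesis
      by (simp add: fejer_conv_sum sum_distrib_left sum_divide_distrib)
  qed
  have "(?R has_integral (\<Sum>j<L. \<Sum>l<L. unit_char (of_int (int j - int l) * x) / of_nat L *
          of_bool (int n - (int j - int l) = 0))) {0..1}"
    by (intro has_integral_sum has_integral_mult_right has_integral_unit_char finite_lessThan)
  also have "(\<Sum>j<L. \<Sum>l<L. unit_char (of_int (int j - int l) * x) / of_nat L *
          of_bool (int n - (int j - int l) = 0)) =
        (\<Sum>l<L. \<Sum>j<L. if j = l + n then unit_char (real n * x) / of_nat L else 0)"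
    by (subst sum.swap) (intro sum.cong refl, auto)
  \<comment> \<open>The index \<open>j = l + n\<close> must stay below \<open>L\<close>, which
    leaves \<open>L - n\<close> values of \<open>l\<close>.\<close>
  also have "\<dots> = (\<Sum>l<L. if l < L - n then unit_char (real n * x) / of_nat L else 0)"
    by (intro sum.cong refl) (simp add: sum.delta less_diff_conv)
  also have "\<dots> = (\<Sum>l\<in>{..<L - n}. unit_char (real n * x) / of_nat L)"
    by (intro sum.mono_neutral_cong_right) auto
  also have "\<dots> = of_real (1 - real n / real L) * unit_char (real n * x)"
    using assms by (simp add: of_nat_diff field_simps)
  finally show ?thesis unfolding eq .
qed

section \<open>Pairings over the unit interval\<close>

lemma integral_mult_le:
  fixes f :: "real \<Rightarrow> complex" and g :: "real \<Rightarrow> complex"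
  assumes "((\<lambda>t. f t * g t) has_integral J) {0..1}"
  assumes "continuous_on {0..1} f" "\<And>t. norm (g t) \<le> B"
  shows "norm J \<le> B * integral {0..1} (\<lambda>t. norm (f t))"
proof -
  have "norm J = norm (integral {0..1} (\<lambda>t. f t * g t))"
    using assms(1) by (simp add: integral_unique)
  also have "\<dots> \<le> integral {0..1} (\<lambda>t. B * norm (f t))"
  proof (rule integral_norm_bound_integral)
    show "(\<lambda>t. f t * g t) integrable_on {0..1}" using assms(1) by blast
    show "(\<lambda>t. B * norm (f t)) integrable_on {0..1}"
      by (intro integrable_continuous_real continuous_intros assms)
    show "norm (f t * g t) \<le> B * norm (f t)" for t
      using mult_right_mono[OF assms(3)[of t], of "norm (f t)"] by (simp add: norm_mult mult_ac)
  qed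
  also have "\<dots> = B * integral {0..1} (\<lambda>t. norm (f t))" by simp
  finally show ?thesis .
qed

text \<open>Parseval's identity. Two separate index sets allow \<open>B\<close> to be a singleton,
  which extracts a single coefficient.\<close>

lemma has_integral_trig_poly_mult_cnj:
  assumes "finite A" "finite B"
  shows "((\<lambda>t. (\<Sum>n\<in>A. a n * unit_char (real n * t)) * cnj (\<Sum>n\<in>B. b n * unit_char (real n * t)))
           has_integral (\<Sum>n\<in>A \<inter> B. a n * cnj (b n))) {0..1}"
proof -
  have eq: "(\<Sum>n\<in>A. a n * unit_char (real n * t)) * cnj (\<Sum>n\<in>B. b n * unit_char (real n * t)) =
     (\<Sum>n\<in>A. \<Sum>m\<in>B. a n * cnj (b m) * unit_char (of_int (int n - int m) * t))" for t
  proof -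
    have "unit_char (of_int (int n - int m) * t) = unit_char (real n * t) * cnj (unit_char (real m * t))"
      for n m
      by (simp add: left_diff_distrib unit_char_diff)
    thus ?thesis
      unfolding cnj_sum sum_product complex_cnj_mult by (simp only: mult_ac)
  qed
  have "((\<lambda>t. \<Sum>n\<in>A. \<Sum>m\<in>B. a n * cnj (b m) * unit_char (of_int (int n - int m) * t)) has_integral
      (\<Sum>n\<in>A. \<Sum>m\<in>B. a n * cnj (b m) * of_bool (int n - int m = 0))) {0..1}"
    by (intro has_integral_sum has_integral_mult_right has_integral_unit_char assms)
  also have "(\<Sum>n\<in>A. \<Sum>m\<in>B. a n * cnj (b m) * of_bool (int n - int m = 0)) =
      (\<Sum>n\<in>A. \<Sum>m\<in>B. if m = n then a n * cnj (b n) else 0)"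
    by (intro sum.cong refl) auto
  also have "\<dots> = (\<Sum>n\<in>A \<inter> B. a n * cnj (b n))"
    using assms by (simp add: sum.delta sum.inter_restrict)
  finally show ?thesis unfolding eq .
qed

text \<open>Over the common denominator the difference has an integer numerator \<open>z\<close>, so
  it suffices that \<open>z\<close> is nonzero. If \<open>z = 0\<close>, then equal primes force
  \<open>a = b\<close> because both lie below \<open>p\<^sup>2\<close>, while distinct primes force
  \<open>p\<^sup>2\<close> to divide \<open>a\<close>, which is positive and smaller.\<close>

lemma prime_square_fractions_spaced:
  fixes p q a b :: nat and k :: int
  assumes "prime p" "prime q" "1 \<le> a" "a < p\<^sup>2" "1 \<le> b" "b < q\<^sup>2" "(p, a) \<noteq> (q, b)"
  shows "\<bar>real a / real (p\<^sup>2) - real b / real (q\<^sup>2) - of_int k\<bar> \<ge> 1 / (real (p\<^sup>2) * real (q\<^sup>2))"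
proof -
  define P Q where "P = p\<^sup>2" and "Q = q\<^sup>2"
  have pos: "P > 0" "Q > 0" using assms by (auto simp: P_def Q_def prime_gt_0_nat)
  define z where "z = int a * int Q - int b * int P - k * int P * int Q"
  have "z \<noteq> 0"
  proof
    assume "z = 0"
    hence z: "int a * int Q = int P * (int b + k * int Q)" by (simp add: z_def algebra_simps)
    show False
    proof (cases "p = q")
      case True
      hence "int Q * int a = int Q * (int b + k * int Q)"
        using z by (simp add: P_def Q_def mult.commute)
      hence eq: "int a - int b = int Q * k" using pos by (simp add: mult.commute)
      have "int a < int Q" "int b < int Q"
        using assms True unfolding Q_def of_nat_less_iff by auto
      hence "\<bar>int a - int b\<bar> < int Q" by linarith
      hence "a = b"
        using eq zdvd_imp_le[of "int Q" "\<bar>int a - int b\<bar>"] by fastforce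
      thus False using assms True by simp
    next
      case False
      hence "coprime P Q" unfolding P_def Q_def using assms by (simp add: primes_coprime)
      moreover have "int P dvd int (a * Q)" using z by simp
      hence "P dvd a * Q" by (simp only: int_dvd_int_iff)
      ultimately have "P dvd a" by (simp add: coprime_dvd_mult_left_iff)
      thus False using assms by (auto simp: P_def dest: dvd_imp_le)
    qed
  qed
  hence "1 \<le> \<bar>real_of_int z\<bar>" by linarith
  have "real a / real P - real b / real Q - of_int k = of_int z / (real P * real Q)"
    using pos by (simp add: z_def field_simps)
  moreover have "\<bar>of_int z / (real P * real Q)\<bar> = \<bar>of_int z\<bar> / (real P * real Q)"
    unfolding abs_divide by simp
  moreover have "1 / (real P * real Q) \<le> \<bar>real_of_int z\<bar> / (real P * real Q)"
    using \<open>1 \<le> \<bar>real_of_int z\<bar>\<close> by (intro divide_right_mono) auto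
  ultimately have "1 / (real P * real Q) \<le> \<bar>real a / real P - real b / real Q - of_int k\<bar>"
    by (simp only:)
  thus ?thesis by (simp add: P_def Q_def)
qed

text \<open>Vanishing on the multiples of \<open>p\<^sup>2\<close> makes the full sum over \<open>a mod p\<^sup>2\<close> vanish, so that
  each prime contributes \<open>-1\<close>, coming from the omitted term \<open>a = 0\<close>.\<close>

lemma sum_unit_char_prime_square_fractions:
  fixes n :: nat
  assumes "finite A" "\<And>p. p \<in> A \<Longrightarrow> prime p \<and> \<not> p\<^sup>2 dvd n"
  shows "(\<Sum>(p, a)\<in>(SIGMA p:A. {1..<p\<^sup>2}). unit_char (real n * (real a / real (p\<^sup>2)))) =
           - of_nat (card A)"
proof -
  have "(\<Sum>a\<in>{1..<p\<^sup>2}. unit_char (real n * (real a / real (p\<^sup>2)))) = -1" if p: "p \<in> A" for p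
  proof -
    have p0: "p\<^sup>2 > 0" using assms(2)[OF p] by (simp add: prime_gt_0_nat)
    have "0 = (\<Sum>a<p\<^sup>2. unit_char (real n * (real a / real (p\<^sup>2))))"
      using sum_unit_char_roots[OF p0] assms(2)[OF p] by simp
    also have "{..<p\<^sup>2} = insert 0 {1..<p\<^sup>2}" using p0 by auto
    finally show ?thesis by (simp add: eq_neg_iff_add_eq_0 add.commute)
  qed
  thus ?thesis using assms(1) by (simp flip: sum.Sigma)
qed

text \<open>The argument uses only that the coefficients vanish on multiples of prime squares. The
  \<open>L\<^sup>1\<close> norm enters twice, once in the sup bound for the convolution
  \<open>T\<close> and once in pairing \<open>S\<close> with \<open>T\<close>. The constant is
  \<open>4 * L = 8 * N\<close> from the kernel, doubled by the weights.\<close>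

lemma L1_norm_lower_bound:
  fixes a :: "nat \<Rightarrow> complex" and N P :: nat
  defines "S \<equiv> (\<lambda>t. \<Sum>n=1..N. a n * unit_char (real n * t))"
  assumes vanish: "\<And>p n. prime p \<Longrightarrow> p\<^sup>2 dvd n \<Longrightarrow> a n = 0"
  assumes P: "P ^ 4 \<le> 2 * N"
  shows "real (card {p. prime p \<and> p \<le> P}) * (\<Sum>n=1..N. (norm (a n))\<^sup>2)
           \<le> 16 * real N * (integral {0..1} (\<lambda>t. norm (S t)))\<^sup>2"
proof (cases "N = 0")
  case False
  \<comment> \<open>Twice the length of the sum keeps the weights \<open>w n\<close> at least
    \<open>1 / 2\<close> for \<open>n \<le> N\<close>.\<close>
  define L where "L = 2 * N"
  define A where "A = {p. prime p \<and> p \<le> P}"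
  define F where "F = (SIGMA p:A. {1..<p\<^sup>2})"
  define \<beta> where "\<beta> = (\<lambda>(p, b). real b / real (p\<^sup>2))"
  define I where "I = integral {0..1} (\<lambda>t. norm (S t))"
  \<comment> \<open>The centres are \<open>- \<beta> i\<close>, which modulo 1 are the same
    fractions as the \<open>\<beta> i\<close>.\<close>
  define K where "K u = (\<Sum>i\<in>F. fejer L (u + \<beta> i))" for u
  define w where "w n = 1 - real n / real L" for n
  define T where "T x = (\<Sum>n=1..N. of_real (w n) * (- of_nat (card A)) * a n * unit_char (real n * x))" for x
  have L: "L > 0" using False by (simp add: L_def)
  have finA: "finite A" unfolding A_def by simp
  have finF: "finite F" unfolding F_def using finA by auto
  have contS: "continuous_on {0..1} S" unfolding S_def by (intro continuous_intros)

  have K_le: "norm (complex_of_real (K u)) \<le> 4 * real L" for u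
  proof -
    have "K u \<le> 4 * real L"
      unfolding K_def
    proof (rule sum_fejer_le[OF finF L])
      fix i j k assume ij: "i \<in> F" "j \<in> F" "i \<noteq> j"
      obtain p b q c where i: "i = (p, b)" and j: "j = (q, c)" by (cases i, cases j)
      have pq: "prime p" "prime q" "p \<le> P" "q \<le> P" "1 \<le> b" "b < p\<^sup>2" "1 \<le> c" "c < q\<^sup>2"
        using ij by (auto simp: F_def A_def i j)
      have "p\<^sup>2 * q\<^sup>2 \<le> P\<^sup>2 * P\<^sup>2" using pq by (intro mult_mono power_mono) auto
      also have "\<dots> = P ^ 4" by (simp flip: power_add)
      also have "\<dots> \<le> L" using P by (simp add: L_def)
      finally have "real (p\<^sup>2 * q\<^sup>2) \<le> real L" by (rule of_nat_mono)
      hence "1 / real L \<le> 1 / (real (p\<^sup>2) * real (q\<^sup>2))"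
        using pq L by (intro divide_left_mono) (auto simp: prime_gt_0_nat)
      also have "\<dots> \<le> \<bar>real b / real (p\<^sup>2) - real c / real (q\<^sup>2) - of_int k\<bar>"
        using ij i j by (intro prime_square_fractions_spaced pq) auto
      finally show "1 / real L \<le> \<bar>u + \<beta> i - (u + \<beta> j) - of_int k\<bar>"
        by (simp add: \<beta>_def i j)
    qed
    moreover have "K u \<ge> 0" unfolding K_def by (intro sum_nonneg fejer_nonneg)
    ultimately show ?thesis by simp
  qed

  have conv: "((\<lambda>t. S t * of_real (K (x - t))) has_integral T x) {0..1}" for x
  proof -
    have eq: "S t * of_real (K (x - t)) = (\<Sum>n=1..N. \<Sum>i\<in>F. a n *
        (unit_char (real n * t) * of_real (fejer L ((x + \<beta> i) - t))))" for t
      by (simp add: S_def K_def sum_product mult.assoc add_diff_eq diff_add_eq)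
    have "((\<lambda>t. S t * of_real (K (x - t))) has_integral (\<Sum>n=1..N. \<Sum>i\<in>F. a n *
        (of_real (1 - real n / real L) * unit_char (real n * (x + \<beta> i))))) {0..1}"
      unfolding eq
      by (intro has_integral_sum has_integral_mult_right has_integral_unit_char_fejer finF)
         (use False in \<open>auto simp: L_def\<close>)
    also have "(\<Sum>n=1..N. \<Sum>i\<in>F. a n * (of_real (1 - real n / real L) * unit_char (real n * (x + \<beta> i)))) = T x"
      unfolding T_def
    proof (rule sum.cong[OF refl])
      fix n
      have "(\<Sum>i\<in>F. a n * (of_real (1 - real n / real L) * unit_char (real n * (x + \<beta> i)))) =
          a n * of_real (w n) * unit_char (real n * x) * (\<Sum>i\<in>F. unit_char (real n * \<beta> i))"
        by (simp add: sum_distrib_left distrib_left unit_char_add w_def mult_ac)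
      also have "\<dots> = of_real (w n) * (- of_nat (card A)) * a n * unit_char (real n * x)"
      \<comment> \<open>When \<open>a n\<close> is nonzero, the hypothesis \<open>vanish\<close>
        shows that no \<open>p\<^sup>2\<close> with \<open>p\<close> in \<open>A\<close> divides
        \<open>n\<close>, so the character sum over the fractions can be evaluated.\<close>
      proof (cases "a n = 0")
        case False
        have "(\<Sum>i\<in>F. unit_char (real n * \<beta> i)) = - of_nat (card A)"
          using sum_unit_char_prime_square_fractions[OF finA, of n] vanish False
          by (auto simp: F_def \<beta>_def case_prod_unfold A_def)
        thus ?thesis by simp
      qed simp
      finally show "(\<Sum>i\<in>F. a n * (of_real (1 - real n / real L) * unit_char (real n * (x + \<beta> i)))) =
          of_real (w n) * (- of_nat (card A)) * a n * unit_char (real n * x)" .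
    qed
    finally show ?thesis .
  qed

  have T_le: "norm (T x) \<le> 4 * real L * I" for x
    unfolding I_def by (rule integral_mult_le[OF conv[of x] contS K_le])

  define J where "J = (\<Sum>n=1..N. a n * cnj (of_real (w n) * (- of_nat (card A)) * a n))"
  have hasJ: "((\<lambda>t. S t * cnj (T t)) has_integral J) {0..1}"
    unfolding S_def T_def J_def
    using has_integral_trig_poly_mult_cnj[where A = "{1..N}" and B = "{1..N}" and a = a and
        b = "\<lambda>n. of_real (w n) * (- of_nat (card A)) * a n", OF finite_atLeastAtMost finite_atLeastAtMost]
    by (simp only: Int_absorb)
  \<comment> \<open>The pairing bound is applied a second time, now with the conjugate of
    \<open>T\<close> as the bounded factor.\<close>
  have "norm J \<le> (4 * real L * I) * I"
    using integral_mult_le[where f = S and g = "\<lambda>t. cnj (T t)" and B = "4 * real L * I",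
        OF hasJ contS] T_le
    by (simp add: I_def)
  also have "J = of_real (- real (card A) * (\<Sum>n=1..N. w n * (norm (a n))\<^sup>2))"
  proof -
    have "(complex_of_real (norm z))\<^sup>2 = z * cnj z" for z
      by (metis complex_norm_square of_real_power)
    moreover have "J = (\<Sum>n=1..N. - (of_nat (card A) * (of_real (w n) * (a n * cnj (a n)))))"
      unfolding J_def by (intro sum.cong refl) (simp add: mult_ac)
    ultimately show ?thesis by (simp add: sum_distrib_left sum_negf)
  qed
  finally have le: "\<bar>- real (card A) * (\<Sum>n=1..N. w n * (norm (a n))\<^sup>2)\<bar> \<le> 4 * real L * I * I"
    by (simp only: norm_of_real)
  have w: "w n \<ge> 1 / 2" if "n \<le> N" for n
    using that False by (simp add: w_def L_def field_simps)
  have "real (card A) * (\<Sum>n=1..N. 1 / 2 * (norm (a n))\<^sup>2) \<le> real (card A) * (\<Sum>n=1..N. w n * (norm (a n))\<^sup>2)"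
    using w by (intro mult_left_mono sum_mono mult_right_mono) auto
  also have "\<dots> \<le> 4 * real L * I * I" using le by linarith
  finally have "real (card A) * (\<Sum>n=1..N. (norm (a n))\<^sup>2) \<le> 16 * real N * I\<^sup>2"
    by (simp add: L_def power2_eq_square flip: sum_divide_distrib)
  thus ?thesis by (simp add: A_def I_def)
qed simp

text \<open>Pairing with a single character recovers the coefficient. For the Moebius sum,
  \<open>k = 1\<close> gives the bound 1 that settles small \<open>N\<close>.\<close>

lemma norm_coeff_le_L1_norm:
  assumes "1 \<le> k" "k \<le> N"
  shows "norm (a k) \<le> integral {0..1} (\<lambda>t. norm (\<Sum>n=1..N. a n * unit_char (real n * t)))"
proof -
  have "{1..N} \<inter> {k} = {k}" using assms by auto
  hence "((\<lambda>t. (\<Sum>n=1..N. a n * unit_char (real n * t)) * cnj (unit_char (real k * t)))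
      has_integral a k) {0..1}"
    using has_integral_trig_poly_mult_cnj[of "{1..N}" "{k}" a "\<lambda>_. 1"] by simp
  from integral_mult_le[OF this, of 1] show ?thesis
    by (simp add: continuous_on_sum continuous_on_mult continuous_on_unit_char continuous_on_const continuous_on_id)
qed

section \<open>Application to the Moebius function\<close>

lemma moebius_mu_eq_0:
  assumes "prime p" "p\<^sup>2 dvd n"
  shows "moebius_mu n = 0"
  using assms not_prime_unit[of p] by (auto simp: moebius_mu_def dest: squarefreeD)

lemma norm_moebius_mu_sq: "(norm (of_int (moebius_mu n) :: complex))\<^sup>2 = of_bool (squarefree n)"
  by (simp add: moebius_mu_def minus_one_power_iff)

lemma L1_norm_moebius_sq_ge:
  fixes N :: nat
  assumes N: "N \<ge> 16"
  defines "I \<equiv> integral {0..1} (\<lambda>t. norm (\<Sum>n=1..N. of_int (moebius_mu n) * unit_char (real n * t)))"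
  shows "I\<^sup>2 \<ge> real N powr (1/4) / (1024 * ln (real N))"
proof -
  define R where "R = real N powr (1/4)"
  \<comment> \<open>The cutoff for the primes is \<open>P = 2 * m\<close>, even to fit the Chebyshev
    bound and at most the fourth root \<open>R\<close> of \<open>N\<close>. The assumption
    \<open>N \<ge> 16\<close> gives \<open>R \<ge> 2\<close>, hence
    \<open>m \<ge> 1\<close>.\<close>
  define m where "m = nat \<lfloor>R / 2\<rfloor>"
  define \<pi> where "\<pi> = real (card {p. prime p \<and> p \<le> 2 * m})"
  have "(16::real) powr (1/4) \<le> R" unfolding R_def using N by (intro powr_mono2) auto
  moreover have "(16::real) powr (1/4) = 2"
    using powr_powr[of 2 4 "1/4"] by simp
  ultimately have R: "R \<ge> 2" by simp
  have "1 \<le> \<lfloor>R / 2\<rfloor>" using R by (simp add: le_floor_iff)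
  hence "real m = of_int \<lfloor>R / 2\<rfloor>" "m \<ge> 1" by (auto simp: m_def le_nat_iff)
  hence m: "real m \<le> R / 2" "real m \<ge> R / 4" "m \<ge> 1" by linarith+
  have "real ((2 * m) ^ 4) \<le> R ^ 4"
    unfolding of_nat_power using m by (intro power_mono) auto
  also have "R ^ 4 = real N" using N by (simp add: R_def powr_power)
  finally have m4: "(2 * m) ^ 4 \<le> N" by linarith
  have "2 * m \<le> (2 * m) ^ 4" using m by (intro self_le_power) auto
  hence mN: "2 * m \<le> N" using m4 by linarith
  have lnN: "ln (real N) > 0" using N by simp
  have "R / 8 \<le> real m * ln 2"
    using m ln2_ge_two_thirds mult_mono[of "R/4" "real m" "1/2" "ln 2"] R by simp
  also have "\<dots> \<le> \<pi> * ln (real (2 * m))"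
    unfolding \<pi>_def by (rule chebyshev_lower) (use m in auto)
  also have "\<dots> \<le> \<pi> * ln (real N)"
    using mN m by (intro mult_left_mono ln_mono) (auto simp: \<pi>_def)
  finally have pi_ge: "R / 8 / ln (real N) \<le> \<pi>" using lnN by (simp add: divide_le_eq)

  have "(\<Sum>n=1..N. (norm (of_int (moebius_mu n) :: complex))\<^sup>2) = real (card {n\<in>{1..N}. squarefree n})"
    unfolding norm_moebius_mu_sq by (simp add: sum.If_cases of_bool_def Int_def)
  hence "\<pi> * (real N / 4) \<le> \<pi> * (\<Sum>n=1..N. (norm (of_int (moebius_mu n) :: complex))\<^sup>2)"
    using card_squarefree_ge[of N] by (intro mult_left_mono) (auto simp: \<pi>_def)
  also have "\<dots> \<le> 16 * real N * I\<^sup>2"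
    unfolding \<pi>_def I_def
    by (rule L1_norm_lower_bound) (use m4 in \<open>auto simp: moebius_mu_eq_0\<close>)
  finally have "real N * \<pi> \<le> real N * (64 * I\<^sup>2)" by (simp add: mult_ac)
  hence "\<pi> \<le> 64 * I\<^sup>2" using N by simp
  with pi_ge have "R / 8 / ln (real N) \<le> 64 * I\<^sup>2" by simp
  moreover have "R / 8 / ln (real N) \<ge> 0" using R lnN by simp
  \<comment> \<open>The estimates give 512 in place of 1024; the weaker constant is the perfect
    square \<open>32\<^sup>2\<close>.\<close>
  moreover have "R / (1024 * ln (real N)) = R / 8 / ln (real N) / 128" by simp
  ultimately have "R / (1024 * ln (real N)) \<le> I\<^sup>2" by linarith
  thus ?thesis by (simp add: R_def)
qed

theorem corollary2:
  shows "\<exists>c::real. c > 0 \<and> (\<forall>N::nat. N \<ge> 2 \<longrightarrow>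
    integral {0..1} (\<lambda>\<alpha>::real. norm (\<Sum>n=1..N. of_int (moebius_mu n) * unit_char (real n * \<alpha>)))
      \<ge> c * (real N powr (1/8) / ln (real N) powr (1/2)))"
\<comment> \<open>The witness is the square root of \<open>1 / 1024\<close>, since the bound is
  proved for the squares.\<close>
proof (intro exI[of _ "1 / 32"] conjI allI impI)
  fix N :: nat
  assume N: "N \<ge> 2"
  define I where "I = integral {0..1} (\<lambda>t. norm (\<Sum>n=1..N. of_int (moebius_mu n) * unit_char (real n * t)))"
  have I1: "1 \<le> I"
    using norm_coeff_le_L1_norm[of 1 N "\<lambda>n. of_int (moebius_mu n)"] N
    by (simp add: I_def moebius_mu_def)
  define X where "X = 1 / 32 * (real N powr (1/8) / ln (real N) powr (1/2))"
  have lnN: "ln (real N) > 0" using N by simp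
  have X2: "X\<^sup>2 = real N powr (1/4) / (1024 * ln (real N))"
  proof -
    have "(real N powr (1/8))\<^sup>2 = real N powr (1/4)" "(ln (real N) powr (1/2))\<^sup>2 = ln (real N)"
      using lnN by (simp_all add: power2_eq_square flip: powr_add)
    thus ?thesis by (simp add: X_def power_divide power_mult_distrib)
  qed
  have "X\<^sup>2 \<le> I\<^sup>2"
  proof (cases "N \<ge> 16")
    case True
    thus ?thesis using L1_norm_moebius_sq_ge[OF True] by (simp add: X2 I_def)
  next
    case False
    \<comment> \<open>For \<open>N < 16\<close> the claimed bound is below 1, while the coefficient
      at \<open>n = 1\<close> already gives \<open>I \<ge> 1\<close>.\<close>
    have "real N powr (1/4) \<le> real N powr 1" using N by (intro powr_mono) auto
    hence "real N powr (1/4) \<le> 16" using False N by simp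
    moreover have "ln (real N) \<ge> 2 / 3"
    proof -
      have "ln 2 \<le> ln (real N)" using N by simp
      thus ?thesis using ln2_ge_two_thirds by linarith
    qed
    ultimately have "X\<^sup>2 \<le> 1" unfolding X2 by (simp add: divide_le_eq)
    also have "1 \<le> I\<^sup>2" using I1 by simp
    finally show ?thesis .
  qed
  hence "X \<le> I" by (rule power2_le_imp_le) (use I1 in simp)
  thus "1 / 32 * (real N powr (1/8) / ln (real N) powr (1/2)) \<le>
      integral {0..1} (\<lambda>\<alpha>::real. norm (\<Sum>n=1..N. of_int (moebius_mu n) * unit_char (real n * \<alpha>)))"
    by (simp add: X_def I_def)
qed simp

end
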